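(* Let $\Gamma$ be a simple connected graph with $n$ vertices, and let $\Gamma_1,\dots,\Gamma_m$ be its 2-vertex connected components. Then the defect $1$ group of $\Gamma$ is the direct product of the defect $1$ groups of the $\Gamma_i$ ($1\le i\le m$).
   Context: All graphs are finite, simple (no loops, no multiple edges) and undirected. For a graph $\Gamma=(V,E)$, the flow semigroup $S_\Gamma$ is the semigroup of transformations of $V$ (acting on the right, composed left to right) generated by the elementary collapsings $e_{uv}$ and $e_{vu}$ for all edges $uv\in E$, where $e_{uv}$ maps $u$ to $v$ and fixes every other vertex. For $1\le k\le |V|-1$ and $V_k\subseteq V$ with $|V_k|=k$, the defect $k$ group $G_{k,V_k}$ is the permutation group on $V\setminus V_k$ generated by the restrictions $s|_{V\setminus V_k}$ of all $s\in S_\Gamma$ with $(V\setminus V_k)s=V\setminus V_k$ and $V_k s\subseteq V\setminus V_k$. For connected $\Gamma$ this group is independent of the choice of $V_k$ up to isomorphism of permutation groups, and is called the defect $k$ group of $\Gamma$. A connected graph with at least 2 vertices is 2-vertex connected if removing any single vertex does not disconnect it; the 2-vertex connected components (blocks) of $\Gamma$ are its maximal 2-vertex connected subgraphs (a single edge not on any cycle is such a component). *)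

theory Defs
  imports "Graph_Theory.Pair_Digraph" "Graph_Theory.Digraph_Component"
    "HOL-Algebra.Bij" "HOL-Algebra.Product_Groups"
begin

text \<open>A finite simple undirected graph is a \<^locale>\<open>pair_graph\<close>: a finite loop-free digraph whose
  arc relation is symmetric, an edge \<open>uv\<close> being the two arcs \<open>(u, v)\<close> and \<open>(v, u)\<close>.\<close>

definition collapse :: "'a \<Rightarrow> 'a \<Rightarrow> 'a \<Rightarrow> 'a"
  where "collapse u v = id(u := v)"

text \<open>A transformation of the vertex set is represented by its extension to the whole type by the
  identity. As maps act on the right, the product of \<open>s\<close> and \<open>t\<close> is \<open>t \<circ> s\<close>. The
  empty product is not included.\<close>

inductive_set flow_semigroup :: "'a pair_pre_digraph \<Rightarrow> ('a \<Rightarrow> 'a) set"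
  for G :: "'a pair_pre_digraph"
where
  gen: "(u, v) \<in> parcs G \<Longrightarrow> collapse u v \<in> flow_semigroup G"
| mult: "s \<in> flow_semigroup G \<Longrightarrow> t \<in> flow_semigroup G \<Longrightarrow> t \<circ> s \<in> flow_semigroup G"

text \<open>The multiplication of \<^const>\<open>BijGroup\<close> composes right to left, so what is defined here is the
  opposite of the group composed left to right. The two have the same underlying set of permutations
  and the same generated subgroups, and a map between two such groups is an isomorphism for one
  convention iff it is one for the other.\<close>

definition defect_group :: "'a pair_pre_digraph \<Rightarrow> 'a set \<Rightarrow> ('a \<Rightarrow> 'a) monoid"
  where "defect_group G W =
    subgroup_generated (BijGroup (pverts G - W))
      {restrict s (pverts G - W) | s. s \<in> flow_semigroup G \<and>
         s ` (pverts G - W) = pverts G - W \<and> s ` W \<subseteq> pverts G - W}"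

definition two_vertex_connected :: "'a pair_pre_digraph \<Rightarrow> bool"
  where "two_vertex_connected H \<longleftrightarrow>
    Digraph_Component.connected (with_proj H) \<and> 2 \<le> card (pverts H) \<and>
    (\<forall>v\<in>pverts H. Digraph_Component.connected (pre_digraph.del_vert (with_proj H) v))"

definition blocks :: "'a pair_pre_digraph \<Rightarrow> 'a pair_pre_digraph set"
  where "blocks G =
    {H. pair_graph H \<and> subgraph (with_proj H) (with_proj G) \<and> two_vertex_connected H \<and>
      (\<forall>K. pair_graph K \<and> subgraph (with_proj K) (with_proj G) \<and> two_vertex_connected K \<and>
         subgraph (with_proj H) (with_proj K) \<longrightarrow> K = H)}"

end

theory Submission
  imports Defs "HOL-Combinatorics.Transposition"
begin

text \<open>The defect 1 group based at \<open>v\<close> consists of the permutations of the tokens on \<open>V - {v}\<close> that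
  are induced by closed walks of a hole from \<open>v\<close> to \<open>v\<close>. Every block \<open>B\<close> has a root: the vertex of
  \<open>B\<close> through which every walk from \<open>v\<close> into \<open>B\<close> passes, and \<open>V - {v}\<close> is the disjoint union of the
  sets \<open>B\<close> minus its root. A closed walk that goes from \<open>v\<close> to the root of \<open>B\<close>, makes a tour inside
  \<open>B\<close> and returns the way it came permutes the tokens of \<open>B\<close> as the tour does and moves nothing else,
  because the way to the root avoids the rest of \<open>B\<close>. These walks generate all closed walks, so the
  group is the direct product of the groups of the blocks based at their roots; changing the base
  point inside a block conjugates its group by a walk.\<close>

section \<open>Connected and 2-connected vertex sets\<close>

text \<open>Walks in \<open>rtrancl_on S E\<close> stay inside \<open>S\<close>, so this is
  connectivity of the induced subgraph on \<open>S\<close>. Deleting vertices changes only the set,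
  with \<open>E\<close> kept fixed.\<close>

definition conn :: "'a rel \<Rightarrow> 'a set \<Rightarrow> bool"
  where "conn E S \<longleftrightarrow> S \<noteq> {} \<and> (\<forall>x\<in>S. \<forall>y\<in>S. (x, y) \<in> rtrancl_on S E)"

definition two_conn :: "'a rel \<Rightarrow> 'a set \<Rightarrow> bool"
  where "two_conn E S \<longleftrightarrow> conn E S \<and> 2 \<le> card S \<and> (\<forall>z\<in>S. conn E (S - {z}))"

lemma rtrancl_on_subset:
  assumes "(x, y) \<in> rtrancl_on S E" "S \<subseteq> T"
  shows "(x, y) \<in> rtrancl_on T E"
  using assms(1)
proof (induction rule: rtrancl_on_induct)
  case base
  then show ?case using assms by auto
next
  case (step y z)
  then show ?case using assms(2) by (meson rtrancl_on_into_rtrancl_on subsetD)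
qed

lemma conn_singleton: "conn E {x}"
  by (auto simp: conn_def)

lemma conn_rtrancl_on: "conn E S \<Longrightarrow> x \<in> S \<Longrightarrow> y \<in> S \<Longrightarrow> (x, y) \<in> rtrancl_on S E"
  by (auto simp: conn_def)

lemma conn_Un:
  assumes "conn E S" "conn E T" "S \<inter> T \<noteq> {}"
  shows "conn E (S \<union> T)"
proof -
  obtain m where m: "m \<in> S" "m \<in> T" using assms(3) by auto
  have *: "(x, m) \<in> rtrancl_on (S \<union> T) E \<and> (m, x) \<in> rtrancl_on (S \<union> T) E"
    if "x \<in> S \<union> T" for x
    using that m assms(1,2)
    by (auto intro: rtrancl_on_subset[OF conn_rtrancl_on])
  show ?thesis
    unfolding conn_def using * m(1) by (blast intro: rtrancl_on_trans)
qed

lemma conn_edge: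
  assumes "(x, y) \<in> E" "sym E"
  shows "conn E {x, y}"
proof -
  have "(y, x) \<in> E" using assms by (auto elim: symE)
  then have "(x, y) \<in> rtrancl_on {x, y} E" "(y, x) \<in> rtrancl_on {x, y} E"
    using assms(1) by (auto intro: rtrancl_on_into_rtrancl_on)
  then show ?thesis by (auto simp: conn_def)
qed

lemma conn_path:
  assumes "sym E" "p \<noteq> []" "successively (\<lambda>x y. (x, y) \<in> E) p"
  shows "conn E (set p)"
  using assms(2,3)
proof (induction p rule: induct_list012)
  case (3 x y zs)
  then have "conn E {x, y}" "conn E (set (y # zs))" using assms(1) conn_edge by auto
  then have "conn E ({x, y} \<union> set (y # zs))" by (intro conn_Un) auto
  then show ?case by (simp add: insert_commute)
qed (auto intro: conn_singleton)

lemma rtrancl_on_distinct_path: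
  assumes "(a, b) \<in> rtrancl_on S E"
  shows "\<exists>p. p \<noteq> [] \<and> distinct p \<and> set p \<subseteq> S \<and> successively (\<lambda>x y. (x, y) \<in> E) p
    \<and> hd p = a \<and> last p = b"
  using assms
proof (induction rule: rtrancl_on_induct)
  case base
  then show ?case by (intro exI[of _ "[a]"]) auto
next
  case (step y z)
  then obtain p where p: "p \<noteq> []" "distinct p" "set p \<subseteq> S"
    "successively (\<lambda>x y. (x, y) \<in> E) p" "hd p = a" "last p = y" by blast
  show ?case
  proof (cases "z \<in> set p")
    case True
    then obtain xs ys where "p = xs @ z # ys" by (meson split_list)
    then show ?thesis using p
      by (intro exI[of _ "xs @ [z]"]) (auto simp: successively_append_iff hd_append)
  next
    case False
    then show ?thesis using p step
      by (intro exI[of _ "p @ [z]"]) (auto simp: successively_append_iff)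
  qed
qed

text \<open>When a vertex of \<open>S\<close> is deleted, the ear still hangs on the rest of
  \<open>S\<close> by at least one end. A vertex deleted from the ear leaves two pieces, each
  attached to \<open>S\<close> by its own end.\<close>

lemma two_conn_ear:
  assumes E: "sym E" and S: "two_conn E S" "finite S"
    and ab: "a \<in> S" "b \<in> S" "a \<noteq> b"
    and p: "distinct p" "set p \<inter> S = {}" "successively (\<lambda>x y. (x, y) \<in> E) (a # p @ [b])"
  shows "two_conn E (S \<union> set p)"
proof -
  have S': "conn E S" "2 \<le> card S" "\<And>z. z \<in> S \<Longrightarrow> conn E (S - {z})"
    using S by (auto simp: two_conn_def)
  have ap: "conn E (set (a # p))"
    using p(3) by (intro conn_path[OF E]) (auto simp: successively_append_iff simp flip: append_Cons)
  have pb: "conn E (set (p @ [b]))"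
    using p(3) by (intro conn_path[OF E]) (auto simp: successively_append_iff successively_Cons)
  have conn: "conn E (S \<union> set p)"
    using conn_Un[OF S'(1) ap] ab by (auto simp: insert_absorb)
  have "conn E (S \<union> set p - {z})" if z: "z \<in> S \<union> set p" for z
  proof (cases "z \<in> S")
    case True
    show ?thesis
    proof (cases "z = a")
      case True
      have "conn E ((S - {z}) \<union> set (p @ [b]))"
        using True ab by (intro conn_Un[OF S'(3) pb]) auto
      moreover have "(S - {z}) \<union> set (p @ [b]) = S \<union> set p - {z}"
        using True ab p(2) by auto
      ultimately show ?thesis by simp
    next
      case False
      have "conn E ((S - {z}) \<union> set (a # p))"
        using False ab True by (intro conn_Un[OF S'(3) ap]) auto
      moreover have "(S - {z}) \<union> set (a # p) = S \<union> set p - {z}"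
        using True False ab p(2) by auto
      ultimately show ?thesis by simp
    qed
  next
    case False
    then obtain xs ys where xy: "p = xs @ z # ys" using z by (meson UnE split_list)
    have "successively (\<lambda>x y. (x, y) \<in> E) ((a # xs) @ z # ys @ [b])"
      using p(3) xy by simp
    then have *: "conn E (set (a # xs))" "conn E (set (ys @ [b]))"
      by (auto intro!: conn_path[OF E] simp: successively_append_iff successively_Cons hd_append
        simp del: set_append set_simps split: if_splits)
    have "conn E (S \<union> set (a # xs))" using * ab by (intro conn_Un[OF S'(1)]) auto
    then have "conn E ((S \<union> set (a # xs)) \<union> set (ys @ [b]))"
      using *(2) by (rule conn_Un) (use ab in auto)
    moreover have "(S \<union> set (a # xs)) \<union> set (ys @ [b]) = S \<union> set p - {z}"
      using xy p(1) ab False by auto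
    ultimately show ?thesis by simp
  qed
  moreover have "2 \<le> card (S \<union> set p)"
    using S'(2) card_mono[of "S \<union> set p" S] S(2) by auto
  ultimately show ?thesis using conn by (simp add: two_conn_def)
qed

text \<open>At least one of \<open>a\<close>, \<open>b\<close> survives the deletion of
  \<open>z\<close> and holds the two connected remainders together.\<close>

lemma two_conn_Un:
  assumes S: "two_conn E S" and T: "two_conn E T" and fin: "finite S" "finite T"
    and ab: "a \<in> S \<inter> T" "b \<in> S \<inter> T" "a \<noteq> b"
  shows "two_conn E (S \<union> T)"
proof -
  have minus: "conn E (S - {z})" "conn E (T - {z})" for z
    using S T by (cases "z \<in> S"; cases "z \<in> T"; auto simp: two_conn_def)+
  have "conn E (S \<union> T - {z})" for z
  proof -
    have "(if z = a then b else a) \<in> (S - {z}) \<inter> (T - {z})" using ab by auto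
    then have "conn E ((S - {z}) \<union> (T - {z}))" by (intro conn_Un minus) blast
    then show ?thesis by (simp add: Un_Diff)
  qed
  moreover have "conn E (S \<union> T)"
    using S T ab by (intro conn_Un) (auto simp: two_conn_def)
  moreover have "2 \<le> card (S \<union> T)"
    using S card_mono[of "S \<union> T" S] fin by (auto simp: two_conn_def)
  ultimately show ?thesis by (auto simp: two_conn_def)
qed

lemma two_conn_edge:
  assumes "(x, y) \<in> E" "sym E" "x \<noteq> y"
  shows "two_conn E {x, y}"
  using conn_edge[OF assms(1,2)] assms(3)
  by (auto simp: two_conn_def insert_Diff_if conn_singleton)

text \<open>A walk is cut at its first vertex in \<open>T\<close>. The predecessor \<open>u\<close>
  in the last conclusion later yields ears and parent blocks.\<close>

lemma rtrancl_on_first_hit: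
  assumes "(a, t0) \<in> rtrancl_on V E" "t0 \<in> T"
  obtains t where "t \<in> T" "t \<in> V" "(a, t) \<in> rtrancl_on (insert t (V - T)) E"
    "a \<notin> T \<Longrightarrow> \<exists>u. (a, u) \<in> rtrancl_on (V - T) E \<and> (u, t) \<in> E"
proof -
  define hit where "hit t \<longleftrightarrow> t \<in> T \<and> t \<in> V \<and> (a, t) \<in> rtrancl_on (insert t (V - T)) E \<and>
    (a \<notin> T \<longrightarrow> (\<exists>u. (a, u) \<in> rtrancl_on (V - T) E \<and> (u, t) \<in> E))" for t
  \<comment> \<open>Invariant along the walk: as long as \<open>T\<close> has not been hit, the walk
    so far lies in \<open>V - T\<close>.\<close>
  have "(\<exists>t. hit t) \<or> (a, t0) \<in> rtrancl_on (V - T) E"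
    using assms(1)
  proof (induction rule: rtrancl_on_induct)
    case base
    then show ?case by (auto simp: hit_def)
  next
    case (step y z)
    show ?case
    proof (cases "\<exists>t. hit t")
      case False
      then have y: "(a, y) \<in> rtrancl_on (V - T) E" using step.IH by blast
      have z: "(a, z) \<in> rtrancl_on (insert z (V - T)) E"
        using rtrancl_on_subset[OF y, of "insert z (V - T)"] step.hyps
        by (auto intro: rtrancl_on_into_rtrancl_on)
      have "z \<notin> T"
        using z y step.hyps False unfolding hit_def by blast
      then show ?thesis using z step.hyps by (auto simp: insert_absorb)
    qed auto
  qed
  then show thesis using assms(2) that by (auto simp: hit_def dest: in_rtrancl_on_in_F)
qed

section \<open>Permutations induced by the walks of a hole\<close>

text \<open>The configurations of defect 1 are those of the 15-puzzle: an elementary collapsing that stays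
  injective on the occupied vertices moves a token into the unique hole. Giving the hole a token of
  its own turns a move along an edge into a transposition. Then \<open>walk_perm E a b \<pi>\<close> says
  that \<open>\<pi>\<close> is induced by a walk of the hole from \<open>a\<close> to \<open>b\<close>.\<close>

inductive walk_perm :: "'a rel \<Rightarrow> 'a \<Rightarrow> 'a \<Rightarrow> ('a \<Rightarrow> 'a) \<Rightarrow> bool"
  for E :: "'a rel" and a :: 'a
where
  stay: "walk_perm E a a id"
| step: "walk_perm E a b \<pi> \<Longrightarrow> (b, c) \<in> E \<Longrightarrow> walk_perm E a c (Transposition.transpose b c \<circ> \<pi>)"

lemma walk_perm_bij: "walk_perm E a b \<pi> \<Longrightarrow> bij \<pi>"
  by (induction rule: walk_perm.induct) (blast intro: bij_id bij_comp bij_transpose)+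

lemma walk_perm_start: "walk_perm E a b \<pi> \<Longrightarrow> \<pi> a = b"
  by (induction rule: walk_perm.induct) auto

lemma walk_perm_mono: "walk_perm E a b \<pi> \<Longrightarrow> E \<subseteq> F \<Longrightarrow> walk_perm F a b \<pi>"
  by (induction rule: walk_perm.induct) (auto intro: walk_perm.intros)

lemma walk_perm_edge: "(a, b) \<in> E \<Longrightarrow> walk_perm E a b (Transposition.transpose a b)"
  using walk_perm.step[OF walk_perm.stay] by auto

lemma walk_perm_trans:
  assumes "walk_perm E b c \<rho>" "walk_perm E a b \<pi>"
  shows "walk_perm E a c (\<rho> \<circ> \<pi>)"
  using assms by (induction rule: walk_perm.induct) (auto intro: walk_perm.step simp: comp_assoc)

lemma walk_perm_inv:
  assumes "walk_perm E a b \<pi>" "sym E"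
  shows "walk_perm E b a (inv_into UNIV \<pi>)"
  using assms(1)
proof (induction rule: walk_perm.induct)
  case stay
  then show ?case using walk_perm.stay[of E a] by (simp add: id_def)
next
  case (step b \<pi> c)
  have "walk_perm E c b (Transposition.transpose b c)"
    using walk_perm_edge[of c b E] step.hyps assms(2) by (auto simp: transpose_commute elim: symE)
  from walk_perm_trans[OF step.IH this] show ?case
    unfolding o_inv_distrib[OF bij_transpose walk_perm_bij[OF step.hyps(1)]] inv_transpose_eq .
qed

lemma walk_perm_exists:
  assumes "(a, b) \<in> rtrancl_on S E"
  shows "\<exists>\<pi>. walk_perm (Restr E S) a b \<pi>"
  using assms
proof (induction rule: rtrancl_on_induct)
  case base
  then show ?case by (blast intro: walk_perm.stay)
next
  case (step y z)
  then show ?case by (blast intro: walk_perm.step)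
qed

lemma walk_perm_in:
  "walk_perm E a b \<pi> \<Longrightarrow> E \<subseteq> S \<times> S \<Longrightarrow> a \<in> S \<Longrightarrow> b \<in> S"
  by (induction rule: walk_perm.induct) auto

lemma walk_perm_outside:
  assumes "walk_perm E a b \<pi>" "E \<subseteq> S \<times> S" "x \<notin> S"
  shows "\<pi> x = x"
  using assms
proof (induction rule: walk_perm.induct)
  case (step b \<pi> c)
  then have "b \<in> S" "c \<in> S" by auto
  then show ?case using step by (auto intro: transpose_apply_other)
qed auto

text \<open>\<open>\<pi>\<close> fixes everything outside \<open>S\<close> and so permutes
  \<open>S\<close>. Removing the token of the hole at both ends leaves the motion of the genuine
  tokens.\<close>

lemma walk_perm_bij_betw:
  assumes \<pi>: "walk_perm E a b \<pi>" and E: "E \<subseteq> S \<times> S" and "a \<in> S"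
  shows "bij_betw \<pi> (S - {a}) (S - {b})"
proof -
  have inj: "inj \<pi>" using walk_perm_bij[OF \<pi>] by (rule bij_is_inj)
  have "\<pi> ` S = S"
  proof -
    have "\<pi> ` (- S) = - S" using walk_perm_outside[OF \<pi> E] by (force simp: image_iff)
    then show ?thesis
      using walk_perm_bij[OF \<pi>] by (metis bij_image_Compl_eq double_complement)
  qed
  then have "\<pi> ` (S - {a}) = S - {b}"
    using walk_perm_start[OF \<pi>] by (simp add: image_set_diff[OF inj])
  then show ?thesis using inj by (simp add: bij_betw_def inj_on_subset[OF inj])
qed

section \<open>Blocks of a rooted graph\<close>

locale rooted_graph =
  fixes E :: "'a rel" and V :: "'a set" and v :: 'a
  assumes sym: "sym E" and loopfree: "(x, x) \<notin> E" and E_sub: "E \<subseteq> V \<times> V"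
    and fin: "finite V" and conn: "conn E V" and root_in: "v \<in> V"
begin

definition block :: "'a set \<Rightarrow> bool"
  where "block S \<longleftrightarrow> S \<subseteq> V \<and> two_conn E S \<and> (\<forall>T. S \<subseteq> T \<and> T \<subseteq> V \<and> two_conn E T \<longrightarrow> T = S)"

text \<open>The dominator relation of flow graphs with entry \<open>v\<close>: no walk in
  \<open>V\<close> from \<open>v\<close> to \<open>x\<close> avoids \<open>a\<close>. In particular
  it is reflexive, and \<open>v\<close> dominates every vertex.\<close>

definition dominates :: "'a \<Rightarrow> 'a \<Rightarrow> bool"
  where "dominates a x \<longleftrightarrow> (v, x) \<notin> rtrancl_on (V - {a}) E"

text \<open>For a block such a vertex exists by \<open>root_exists\<close> and is unique by
  \<open>dominates_antisym\<close>.\<close>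

definition root :: "'a set \<Rightarrow> 'a"
  where "root S = (SOME r. r \<in> S \<and> (\<forall>x\<in>S. dominates r x))"

lemma blockD:
  assumes "block S"
  shows "S \<subseteq> V" "two_conn E S" "\<And>T. S \<subseteq> T \<Longrightarrow> T \<subseteq> V \<Longrightarrow> two_conn E T \<Longrightarrow> T = S"
    "finite S" "conn E S" "\<And>z. z \<in> S \<Longrightarrow> conn E (S - {z})" "S \<noteq> {}"
  using assms finite_subset[OF _ fin] by (auto simp: block_def two_conn_def)

lemma two_conn_in_block:
  assumes "two_conn E T" "T \<subseteq> V"
  obtains S where "block S" "T \<subseteq> S"
proof -
  let ?F = "{S. S \<subseteq> V \<and> two_conn E S}"
  have "finite ?F" using fin by auto
  from finite_has_maximal2[OF this, of T] assms
  obtain S where S: "S \<in> ?F" "T \<subseteq> S" "\<forall>b\<in>?F. S \<le> b \<longrightarrow> S = b" by auto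
  then show thesis using that[of S] by (auto simp: block_def)
qed

lemma edge_in_block:
  assumes "(x, y) \<in> E"
  obtains S where "block S" "x \<in> S" "y \<in> S"
proof -
  have "two_conn E {x, y}" using assms sym loopfree by (intro two_conn_edge) auto
  moreover have "{x, y} \<subseteq> V" using assms E_sub by auto
  ultimately show thesis using that by (rule two_conn_in_block) auto
qed

text \<open>Of two distinct vertices, the one that a walk from \<open>v\<close> meets first is
  reached without the other.\<close>

lemma dominates_antisym:
  assumes "dominates a b" "dominates b a" "a \<in> V"
  shows "a = b"
proof (rule ccontr)
  assume "a \<noteq> b"
  have "(v, a) \<in> rtrancl_on V E" using conn root_in assms(3) by (auto simp: conn_def)
  then obtain t where t: "t \<in> {a, b}" "(v, t) \<in> rtrancl_on (insert t (V - {a, b})) E" "t \<in> V"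
    by (rule rtrancl_on_first_hit[where T = "{a, b}"]) auto
  let ?s = "if t = a then b else a"
  have "(v, t) \<in> rtrancl_on (V - {?s}) E"
    using t \<open>a \<noteq> b\<close> by (intro rtrancl_on_subset[OF t(2)]) auto
  then show False using assms(1,2) t(1) by (auto simp: dominates_def split: if_splits)
qed

text \<open>A walk that avoids \<open>a\<close> cannot meet \<open>b\<close>, since its initial part
  would reach \<open>b\<close> without \<open>a\<close>. So it avoids \<open>b\<close> as well and
  cannot end in \<open>c\<close>.\<close>

lemma dominates_trans:
  assumes "dominates a b" "dominates b c"
  shows "dominates a c"
proof (cases "b = a")
  case False
  show ?thesis unfolding dominates_def
  proof
    assume ac: "(v, c) \<in> rtrancl_on (V - {a}) E"
    have "(v, c) \<in> rtrancl_on (V - {b}) E"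
      using ac
    proof (induction rule: rtrancl_on_induct)
      case base
      then have "v \<noteq> b" using assms(1) by (auto simp: dominates_def)
      then show ?case using root_in by auto
    next
      case (step y z)
      then have "(v, z) \<in> rtrancl_on (V - {a}) E" by (meson rtrancl_on_into_rtrancl_on)
      then have "z \<noteq> b" using assms(1) by (auto simp: dominates_def)
      then show ?case using step by (auto intro: rtrancl_on_into_rtrancl_on)
    qed
    then show False using assms(2) by (simp add: dominates_def)
  qed
qed (use assms in simp)

text \<open>The candidate is the vertex at which some walk from \<open>v\<close> first enters
  \<open>S\<close>.\<close>

lemma root_exists:
  assumes S: "block S"
  shows "\<exists>r. r \<in> S \<and> (\<forall>x\<in>S. dominates r x)"
proof -
  obtain s where "s \<in> S" using blockD(7)[OF S] by auto
  then have "(v, s) \<in> rtrancl_on V E" using conn root_in blockD(1)[OF S] by (auto simp: conn_def)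
  then obtain r where r: "r \<in> S" "(v, r) \<in> rtrancl_on (insert r (V - S)) E"
    "v \<notin> S \<Longrightarrow> \<exists>u. (v, u) \<in> rtrancl_on (V - S) E \<and> (u, r) \<in> E"
    using \<open>s \<in> S\<close> by (rule rtrancl_on_first_hit) auto
  have "dominates r x" if "x \<in> S" for x
    \<comment> \<open>Otherwise a second way into \<open>S\<close> yields an ear, contradicting the maximality of \<open>S\<close>.\<close>
  proof (rule ccontr)
    assume "\<not> dominates r x"
    then have vx: "(v, x) \<in> rtrancl_on (V - {r}) E" by (simp add: dominates_def)
    then have "v \<noteq> r" by (auto dest: in_rtrancl_on_in_F)
    moreover have "v \<in> insert r (V - S)" using r(2) by (rule in_rtrancl_on_in_F)
    ultimately have vS: "v \<notin> S" by auto
    from vx \<open>x \<in> S\<close> obtain y where y: "y \<in> S" "y \<in> V - {r}"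
      "\<exists>u. (v, u) \<in> rtrancl_on (V - {r} - S) E \<and> (u, y) \<in> E"
      by (rule rtrancl_on_first_hit) (use vS in auto)
    obtain u1 u2 where u: "(v, u1) \<in> rtrancl_on (V - S) E" "(u1, r) \<in> E"
      "(v, u2) \<in> rtrancl_on (V - {r} - S) E" "(u2, y) \<in> E"
      using r(3)[OF vS] y(3) by auto
    \<comment> \<open>The two approaches to \<open>S\<close>, joined through \<open>v\<close>,
      connect \<open>u1\<close> with \<open>u2\<close> outside \<open>S\<close>. A simple path
      between them is the ear from \<open>r\<close> to \<open>y\<close>.\<close>
    have "(u1, v) \<in> rtrancl_on (V - S) E" using u(1) rtrancl_on_sym[OF sym] by (auto elim: symE)
    moreover have "(v, u2) \<in> rtrancl_on (V - S) E" by (rule rtrancl_on_subset[OF u(3)]) auto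
    ultimately have "(u1, u2) \<in> rtrancl_on (V - S) E" by (rule rtrancl_on_trans)
    then obtain p where p: "p \<noteq> []" "distinct p" "set p \<subseteq> V - S"
      "successively (\<lambda>x y. (x, y) \<in> E) p" "hd p = u1" "last p = u2"
      using rtrancl_on_distinct_path by metis
    have "(r, u1) \<in> E" using u(2) sym by (auto elim: symE)
    then have "two_conn E (S \<union> set p)"
      using p u y r blockD[OF S]
      by (intro two_conn_ear[OF sym, of S r y]) (auto simp: successively_append_iff successively_Cons)
    then have "S \<union> set p = S" using p(3) blockD(1)[OF S] by (intro blockD(3)[OF S]) auto
    then show False using p(1,3) by (cases p) auto
  qed
  then show ?thesis using r(1) by auto
qed

lemma root_props:
  assumes "block S"
  shows "root S \<in> S" "x \<in> S \<Longrightarrow> dominates (root S) x"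
  using someI_ex[OF root_exists[OF assms]] by (auto simp: root_def)

text \<open>By antisymmetry \<open>root S\<close> is reached from \<open>v\<close> without
  \<open>h\<close>, and since \<open>S - {h}\<close> is connected the walk continues to
  \<open>x\<close>, still avoiding \<open>h\<close>.\<close>

lemma block_not_dominated:
  assumes S: "block S" and hx: "h \<in> S" "h \<noteq> root S" "x \<in> S" "x \<noteq> h"
  shows "\<not> dominates h x"
proof
  assume d: "dominates h x"
  have "(root S, x) \<in> rtrancl_on (S - {h}) E"
    using blockD(6)[OF S, of h] hx root_props(1)[OF S] by (auto intro!: conn_rtrancl_on)
  then have rx: "(root S, x) \<in> rtrancl_on (V - {h}) E"
    using blockD(1)[OF S] by (auto elim: rtrancl_on_subset)
  have "\<not> dominates h (root S)"
    using dominates_antisym root_props[OF S] hx blockD(1)[OF S] by blast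
  then have "(v, root S) \<in> rtrancl_on (V - {h}) E" by (simp add: dominates_def)
  from rtrancl_on_trans[OF this rx] show False using d by (simp add: dominates_def)
qed

text \<open>Different blocks share at most one vertex. Suppose it is a non-root vertex
  \<open>h\<close> of both. A walk from \<open>v\<close> to one root continues inside that block to
  \<open>h\<close>, so it meets the other root, which lies outside that block and hence on the first
  part. Thus the roots dominate each other and coincide, a second common vertex.\<close>

lemma block_root_unique:
  assumes S: "block S" and T: "block T" and h: "h \<in> S - {root S}" "h \<in> T - {root T}"
  shows "S = T"
proof (rule ccontr)
  assume ne: "S \<noteq> T"
  have int: "x = h" if "x \<in> S" "x \<in> T" for x
  proof (rule ccontr)
    assume "x \<noteq> h"
    then have "two_conn E (S \<union> T)"
      using that h blockD[OF S] blockD[OF T] by (intro two_conn_Un[of _ _ _ x h]) auto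
    then have "S \<union> T = S" "S \<union> T = T"
      using blockD(1)[OF S] blockD(1)[OF T] by (intro blockD(3)[OF S] blockD(3)[OF T]; auto)+
    then show False using ne by auto
  qed
  have *: "dominates (root A) (root B)"
    if A: "block A" and B: "block B" and hA: "h \<in> A - {root A}" and hB: "h \<in> B" and
      i: "\<And>x. x \<in> A \<Longrightarrow> x \<in> B \<Longrightarrow> x = h" for A B
    unfolding dominates_def
  proof
    assume r: "(v, root B) \<in> rtrancl_on (V - {root A}) E"
    have "root A \<notin> B" using i root_props(1)[OF A] hA by auto
    moreover have "(root B, h) \<in> rtrancl_on B E"
      using blockD(5)[OF B] root_props(1)[OF B] hB by (auto intro: conn_rtrancl_on)
    ultimately have "(root B, h) \<in> rtrancl_on (V - {root A}) E"
      using blockD(1)[OF B] by (auto elim: rtrancl_on_subset)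
    from rtrancl_on_trans[OF r this] show False
      using root_props(2)[OF A] hA by (auto simp: dominates_def)
  qed
  have "root S = root T"
  proof (rule dominates_antisym)
    show "dominates (root S) (root T)" using h int by (intro *[OF S T]) auto
    show "dominates (root T) (root S)" using h int by (intro *[OF T S]) auto
    show "root S \<in> V" using root_props(1)[OF S] blockD(1)[OF S] by auto
  qed
  then show False using int root_props(1)[OF S] root_props(1)[OF T] h by auto
qed

text \<open>Only \<open>v\<close> dominates \<open>v\<close>, because of the walk of length
  0.\<close>

lemma root_eq_base:
  assumes "block S" "v \<in> S"
  shows "root S = v"
proof (rule ccontr)
  assume "root S \<noteq> v"
  then have "\<not> dominates (root S) v" using root_in by (auto simp: dominates_def)
  then show False using root_props(2)[OF assms] by auto
qed

text \<open>A walk from \<open>v\<close> stopped at its first visit to \<open>x\<close> reaches the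
  predecessor \<open>u\<close> without \<open>x\<close>, so \<open>x\<close> is not the root of the
  block containing the last edge. With \<open>block_root_unique\<close>, the sets
  \<open>S - {root S}\<close> partition \<open>V - {v}\<close>.\<close>

lemma parent_block_exists:
  assumes "x \<in> V" "x \<noteq> v"
  obtains S where "block S" "x \<in> S - {root S}"
proof -
  have "(v, x) \<in> rtrancl_on V E" using conn root_in assms(1) by (auto simp: conn_def)
  then obtain t where "t \<in> {x}" "\<exists>u. (v, u) \<in> rtrancl_on (V - {x}) E \<and> (u, t) \<in> E"
    by (rule rtrancl_on_first_hit[of _ _ _ _ "{x}"]) (use assms(2) in auto)
  then obtain u where u: "(v, u) \<in> rtrancl_on (V - {x}) E" "(u, x) \<in> E" by auto
  obtain S where S: "block S" "u \<in> S" "x \<in> S" using edge_in_block[OF u(2)] by blast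
  have "root S \<noteq> x" using root_props(2)[OF S(1,2)] u(1) by (auto simp: dominates_def)
  then show thesis using that S by auto
qed

section \<open>Decomposition of hole walks along the blocks\<close>

text \<open>Permutations induced by walks that descend from block to block, leaving each block only at the
  root of the next one. Such a walk to \<open>h\<close> meets no vertex strictly dominated by \<open>h\<close>.\<close>

inductive tree_perm :: "'a \<Rightarrow> ('a \<Rightarrow> 'a) \<Rightarrow> bool"
where
  base: "tree_perm v id"
| step: "tree_perm (root S) p \<Longrightarrow> block S \<Longrightarrow> h \<in> S - {root S} \<Longrightarrow>
    walk_perm (Restr E S) (root S) h q \<Longrightarrow> tree_perm h (q \<circ> p)"

text \<open>The intended direct product, realised as maps that act on the tokens of each block by a
  tour from its root. Only the values on \<open>V - {v}\<close> are prescribed.\<close>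

definition block_perms :: "('a \<Rightarrow> 'a) set"
  where "block_perms = {\<sigma>. \<forall>S. block S \<longrightarrow>
    (\<exists>\<beta>. walk_perm (Restr E S) (root S) (root S) \<beta> \<and> (\<forall>x\<in>S - {root S}. \<sigma> x = \<beta> x))}"

lemma tree_perm_walk_perm: "tree_perm h p \<Longrightarrow> walk_perm E v h p"
  by (induction rule: tree_perm.induct)
    (blast intro: walk_perm.stay walk_perm_trans walk_perm_mono[OF _ inf_le1])+

text \<open>By \<open>block_not_dominated\<close>, a vertex strictly dominated by \<open>h\<close>
  lies outside the last block of the descent. It is also strictly dominated by the root of that
  block, so induction applies.\<close>

lemma tree_perm_fixes_dominated:
  assumes "tree_perm h p" "dominates h x" "x \<noteq> h"
  shows "p x = x"
  using assms
proof (induction arbitrary: x rule: tree_perm.induct)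
  case (step S p h q)
  have h: "h \<in> S" "h \<noteq> root S" "h \<in> V" using step.hyps blockD(1) by auto
  have rh: "dominates (root S) h" using root_props[OF step.hyps(2)] h by auto
  have "x \<noteq> root S"
    using dominates_antisym[OF rh] step.prems h root_props(1)[OF step.hyps(2)] blockD(1)[OF step.hyps(2)]
    by auto
  then have "p x = x" using step.IH dominates_trans[OF rh step.prems(1)] by auto
  moreover have "x \<notin> S" using block_not_dominated[OF step.hyps(2) h(1,2)] step.prems by auto
  then have "q x = x" by (intro walk_perm_outside[OF step.hyps(4)]) auto
  ultimately show ?case by simp
qed auto

section \<open>Tours of single blocks and maps that act blockwise\<close>

lemma block_perm_bij:
  assumes "block S" "walk_perm (Restr E S) (root S) (root S) \<beta>"
  shows "bij_betw \<beta> (S - {root S}) (S - {root S})"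
  using walk_perm_bij_betw[OF assms(2), of S] root_props(1)[OF assms(1)] by auto

lemma block_perm_outside:
  assumes "block S" "walk_perm (Restr E S) (root S) (root S) \<beta>" "x \<notin> S - {root S}"
  shows "\<beta> x = x"
  using walk_perm_outside[OF assms(2), of S] walk_perm_start[OF assms(2)] assms(3) by auto

lemma block_perms_id: "id \<in> block_perms"
  unfolding block_perms_def by (blast intro: walk_perm.stay)

lemma block_perms_comp:
  assumes "\<sigma> \<in> block_perms" "\<tau> \<in> block_perms"
  shows "\<sigma> \<circ> \<tau> \<in> block_perms"
  unfolding block_perms_def
proof (intro CollectI allI impI)
  fix S assume S: "block S"
  obtain \<beta> \<gamma> where *: "walk_perm (Restr E S) (root S) (root S) \<beta>" "\<And>x. x \<in> S - {root S} \<Longrightarrow> \<sigma> x = \<beta> x"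
    "walk_perm (Restr E S) (root S) (root S) \<gamma>" "\<And>x. x \<in> S - {root S} \<Longrightarrow> \<tau> x = \<gamma> x"
    using assms S unfolding block_perms_def by blast
  have "(\<sigma> \<circ> \<tau>) x = (\<beta> \<circ> \<gamma>) x" if "x \<in> S - {root S}" for x
    using *(2)[of "\<gamma> x"] *(4)[OF that] bij_betwE[OF block_perm_bij[OF S *(3)]] that by auto
  then show "\<exists>\<beta>. walk_perm (Restr E S) (root S) (root S) \<beta> \<and> (\<forall>x\<in>S - {root S}. (\<sigma> \<circ> \<tau>) x = \<beta> x)"
    using walk_perm_trans[OF *(1,3)] by blast
qed

text \<open>By \<open>block_root_unique\<close>, a tour of \<open>S\<close> moves no non-root vertex
  of another block.\<close>

lemma block_perms_incl:
  assumes S: "block S" and \<beta>: "walk_perm (Restr E S) (root S) (root S) \<beta>"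
  shows "\<beta> \<in> block_perms"
  unfolding block_perms_def
proof (intro CollectI allI impI)
  fix T assume T: "block T"
  show "\<exists>\<gamma>. walk_perm (Restr E T) (root T) (root T) \<gamma> \<and> (\<forall>x\<in>T - {root T}. \<beta> x = \<gamma> x)"
  proof (cases "T = S")
    case False
    then have "\<forall>x\<in>T - {root T}. \<beta> x = id x"
      using block_perm_outside[OF S \<beta>] block_root_unique[OF S T] by auto
    then show ?thesis by (intro exI[of _ id] conjI walk_perm.stay)
  qed (use \<beta> in auto)
qed

text \<open>The supports are disjoint: the descent fixes the non-root vertices of \<open>S\<close>,
  which are the only ones the tour moves.\<close>

lemma tree_perm_commute:
  assumes p: "tree_perm (root S) p" and S: "block S"
    and \<beta>: "walk_perm (Restr E S) (root S) (root S) \<beta>"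
  shows "\<beta> \<circ> p = p \<circ> \<beta>"
proof
  fix x
  have fix_p: "p y = y" if "y \<in> S - {root S}" for y
    using tree_perm_fixes_dominated[OF p] root_props[OF S] that by auto
  show "(\<beta> \<circ> p) x = (p \<circ> \<beta>) x"
  proof (cases "x \<in> S - {root S}")
    case True
    then show ?thesis using fix_p bij_betwE[OF block_perm_bij[OF S \<beta>]] by auto
  next
    case False
    have "inj p" using walk_perm_bij[OF tree_perm_walk_perm[OF p]] by (rule bij_is_inj)
    then have "p x \<notin> S - {root S}" using fix_p False by (metis injD)
    then show ?thesis using block_perm_outside[OF S \<beta>] False by simp
  qed
qed

text \<open>Normal form of a walk: first tours of the blocks, then a descent to the current
  position. Each new edge lies in one block and either enters it from the root, moves inside it, or
  returns to the root. In the last case the finished tour is moved past the descent into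
  \<open>\<sigma>\<close>.\<close>

lemma walk_perm_decompose:
  assumes "walk_perm E v h \<pi>"
  shows "\<exists>p \<sigma>. tree_perm h p \<and> \<sigma> \<in> block_perms \<and> \<pi> = p \<circ> \<sigma>"
  using assms
proof (induction rule: walk_perm.induct)
  case stay
  show ?case
    by (intro exI[of _ id] conjI tree_perm.base block_perms_id) auto
next
  case (step b \<pi> c)
  then obtain p \<sigma> where p: "tree_perm b p" "\<sigma> \<in> block_perms" "\<pi> = p \<circ> \<sigma>" by blast
  let ?t = "Transposition.transpose b c"
  obtain S where S: "block S" "b \<in> S" "c \<in> S" using edge_in_block[OF step.hyps(2)] by blast
  have bc: "(b, c) \<in> Restr E S" using step.hyps(2) S by auto
  show ?case
  proof (cases "b = root S")
    case True
    then have "c \<noteq> root S" using step.hyps(2) loopfree by auto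
    then have "tree_perm c (?t \<circ> p)"
      using True p(1) S walk_perm_edge[OF bc] by (intro tree_perm.step[of S]) auto
    moreover have "?t \<circ> \<pi> = (?t \<circ> p) \<circ> \<sigma>" using p(3) by (simp add: comp_assoc)
    ultimately show ?thesis using p(2) by blast
  next
    case False
    \<comment> \<open>\<open>b\<close> is a non-root vertex of \<open>S\<close> and of no other
      block, so the last stage of the descent runs inside \<open>S\<close>. The base case fails
      because \<open>v\<close> is the root of every block containing it.\<close>
    from p(1) obtain p0 q where q: "p = q \<circ> p0" "tree_perm (root S) p0"
      "walk_perm (Restr E S) (root S) b q"
    proof (cases rule: tree_perm.cases)
      case base
      then show ?thesis using root_eq_base S False by auto
    next
      case (step T p0 q)
      then have "T = S" using block_root_unique S False by auto
      then show ?thesis using that step by blast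
    qed
    have tq: "walk_perm (Restr E S) (root S) c (?t \<circ> q)" using walk_perm.step[OF q(3) bc] .
    show ?thesis
    proof (cases "c = root S")
      case True
      \<comment> \<open>The hole is back at the root, so \<open>?t \<circ> q\<close> is a closed
        tour of \<open>S\<close>.\<close>
      have "(?t \<circ> q) \<circ> p0 = p0 \<circ> (?t \<circ> q)"
        using tq True by (intro tree_perm_commute[OF q(2) S(1)]) simp
      then have "?t \<circ> \<pi> = p0 \<circ> ((?t \<circ> q) \<circ> \<sigma>)"
        using p(3) q(1) by (metis comp_assoc)
      moreover have "(?t \<circ> q) \<circ> \<sigma> \<in> block_perms"
        using tq True by (intro block_perms_comp[OF block_perms_incl[OF S(1)] p(2)]) simp
      ultimately show ?thesis using q(2) True by blast
    next
      case False
      then have "tree_perm c ((?t \<circ> q) \<circ> p0)"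
        using S tq q(2) by (intro tree_perm.step[of S]) auto
      moreover have "?t \<circ> \<pi> = ((?t \<circ> q) \<circ> p0) \<circ> \<sigma>" using p(3) q(1) by (simp add: comp_assoc)
      ultimately show ?thesis using p(2) by blast
    qed
  qed
qed

text \<open>Since \<open>v\<close> is the root of every block containing it, only the empty descent
  ends at \<open>v\<close>.\<close>

lemma walk_perm_closed_block_perms:
  assumes "walk_perm E v v \<pi>"
  shows "\<pi> \<in> block_perms"
proof -
  obtain p \<sigma> where p: "tree_perm v p" "\<sigma> \<in> block_perms" "\<pi> = p \<circ> \<sigma>"
    using walk_perm_decompose[OF assms] by blast
  from p(1) have "p = id"
    by (cases rule: tree_perm.cases) (use root_eq_base in auto)
  then show ?thesis using p by simp
qed

text \<open>Conjugation with a descent to the root yields a closed walk at \<open>v\<close>, and by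
  \<open>tree_perm_commute\<close> it leaves the tour unchanged.\<close>

lemma block_perm_closed_walk:
  assumes S: "block S" and \<beta>: "walk_perm (Restr E S) (root S) (root S) \<beta>"
  shows "walk_perm E v v \<beta>"
proof -
  have "(v, root S) \<in> rtrancl_on V E"
    using conn root_in root_props(1)[OF S] blockD(1)[OF S] by (auto simp: conn_def)
  then obtain \<pi> where "walk_perm E v (root S) \<pi>"
    using walk_perm_exists walk_perm_mono by (metis inf_le1)
  \<comment> \<open>An arbitrary walk to the root supplies a descent once its blockwise part is
    dropped.\<close>
  then obtain p where p: "tree_perm (root S) p" using walk_perm_decompose by blast
  note p' = tree_perm_walk_perm[OF p]
  have "walk_perm E (root S) (root S) \<beta>" using \<beta> by (rule walk_perm_mono) auto
  then have "walk_perm E v v (inv_into UNIV p \<circ> (\<beta> \<circ> p))"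
    by (rule walk_perm_trans[OF walk_perm_inv[OF p' sym] walk_perm_trans[OF _ p']])
  moreover have "inv_into UNIV p \<circ> (\<beta> \<circ> p) = \<beta>"
    using walk_perm_bij[OF p'] unfolding tree_perm_commute[OF p S \<beta>]
    by (simp add: comp_assoc[symmetric] bij_is_inj)
  ultimately show ?thesis by simp
qed

text \<open>Tours of different blocks have disjoint supports, so they can be composed one block at a
  time without disturbing each other.\<close>

lemma block_family_closed_walk:
  assumes "\<And>S. block S \<Longrightarrow> walk_perm (Restr E S) (root S) (root S) (\<beta> S)"
  shows "\<exists>\<pi>. walk_perm E v v \<pi> \<and> (\<forall>S. block S \<longrightarrow> (\<forall>x\<in>S - {root S}. \<pi> x = \<beta> S x))"
proof -
  have "finite {S. block S}" using fin by (rule_tac finite_subset[of _ "Pow V"]) (auto simp: block_def)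
  \<comment> \<open>The claim also records that blocks outside \<open>F\<close> are still untouched.
    At the end \<open>F\<close> is the set of all blocks.\<close>
  moreover have "\<exists>\<pi>. walk_perm E v v \<pi> \<and>
      (\<forall>S. block S \<longrightarrow> (\<forall>x\<in>S - {root S}. \<pi> x = (if S \<in> F then \<beta> S x else x)))"
    if "finite F" "F \<subseteq> {S. block S}" for F
    using that
  proof (induction rule: finite_induct)
    case empty
    then show ?case by (auto intro: exI[of _ id] walk_perm.stay)
  next
    case (insert T F)
    then obtain \<pi> where \<pi>: "walk_perm E v v \<pi>"
      "\<And>S x. block S \<Longrightarrow> x \<in> S - {root S} \<Longrightarrow> \<pi> x = (if S \<in> F then \<beta> S x else x)" by auto
    have T: "block T" using insert.prems by auto
    note \<beta> = assms[OF T]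
    have "(\<pi> \<circ> \<beta> T) x = (if S \<in> insert T F then \<beta> S x else x)"
      if S: "block S" and x: "x \<in> S - {root S}" for S x
    proof (cases "S = T")
      case True
      have "\<beta> T x \<in> T - {root T}" using x True bij_betwE[OF block_perm_bij[OF T \<beta>]] by auto
      then show ?thesis using True \<pi>(2)[OF T, of "\<beta> T x"] insert.hyps by simp
    next
      case False
      then have "\<beta> T x = x" using block_perm_outside[OF T \<beta>] block_root_unique[OF S T x] by auto
      then show ?thesis using \<pi>(2)[OF S x] False by simp
    qed
    then show ?case using walk_perm_trans[OF \<pi>(1) block_perm_closed_walk[OF T \<beta>]] by blast
  qed
  ultimately show ?thesis using order_refl by fastforce
qed

end

section \<open>The defect 1 group as a group of hole walks\<close>

lemma pair_graph_facts:
  assumes "pair_graph H"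
  shows "sym (parcs H)" "(x, x) \<notin> parcs H" "parcs H \<subseteq> pverts H \<times> pverts H"
    "finite (pverts H)"
proof -
  interpret pair_graph H by fact
  show "sym (parcs H)" using pair_sym_arcs by (simp add: symmetric_def)
  show "(x, x) \<notin> parcs H" using pair_no_loops by fastforce
  show "parcs H \<subseteq> pverts H \<times> pverts H" using in_arcsD1 in_arcsD2 by auto
  show "finite (pverts H)" by (fact pair_finite_verts)
qed

lemma collapse_apply: "collapse u w x = (if x = u then w else x)"
  by (simp add: collapse_def)

lemma flow_semigroup_image:
  assumes "s \<in> flow_semigroup H" "parcs H \<subseteq> V \<times> V"
  shows "s ` V \<subseteq> V"
  using assms
proof (induction rule: flow_semigroup.induct)
  case (gen u w)
  then show ?case by (auto simp: collapse_apply)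
next
  case (mult s t)
  then show ?case by (fastforce simp: image_comp[symmetric])
qed

text \<open>The first collapsing of a product already merges two vertices; it exists because the
  empty product is excluded.\<close>

lemma flow_semigroup_not_inj:
  assumes "s \<in> flow_semigroup H" "pair_graph H"
  shows "\<not> inj_on s (pverts H)"
  using assms(1)
proof (induction rule: flow_semigroup.induct)
  case (gen u w)
  then have "u \<in> pverts H" "w \<in> pverts H" "u \<noteq> w"
    using pair_graph_facts[OF assms(2)] by auto
  moreover have "collapse u w u = collapse u w w" by (simp add: collapse_apply)
  ultimately show ?case by (meson inj_onD)
next
  case (mult s t)
  then show ?case by (blast dest: inj_on_imageI2)
qed

text \<open>Injectivity off the hole passes to the first factor. Its image is everything but the new
  hole, so injectivity passes to the second factor too, and only single collapsings remain.\<close>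

lemma flow_semigroup_imp_walk_perm:
  assumes "s \<in> flow_semigroup H" "pair_graph H" "a \<in> pverts H" "inj_on s (pverts H - {a})"
  shows "\<exists>b \<pi>. walk_perm (parcs H) a b \<pi> \<and> (\<forall>x\<in>pverts H - {a}. s x = \<pi> x)"
  using assms(1,3,4)
proof (induction arbitrary: a rule: flow_semigroup.induct)
  case (gen u w)
  have uw: "u \<in> pverts H" "w \<in> pverts H" "u \<noteq> w"
    using gen.hyps pair_graph_facts[OF assms(2)] by auto
  \<comment> \<open>Either no token moves, or the token at \<open>u\<close> moves into the hole, or
    two tokens merge, against injectivity.\<close>
  consider "u = a" | "w = a" | "u \<noteq> a" "w \<noteq> a" by auto
  then show ?case
  proof cases
    case 1
    then have "\<forall>x\<in>pverts H - {a}. collapse u w x = id x" by (simp add: collapse_apply)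
    then show ?thesis using walk_perm.stay by fast
  next
    case 2
    have "(a, u) \<in> parcs H"
      using gen.hyps 2 pair_graph_facts(1)[OF assms(2)] by (auto elim: symE)
    then have "walk_perm (parcs H) a u (Transposition.transpose a u)" by (rule walk_perm_edge)
    moreover have "\<forall>x\<in>pverts H - {a}. collapse u w x = Transposition.transpose a u x"
      using 2 by (auto simp: collapse_apply Transposition.transpose_def)
    ultimately show ?thesis by blast
  next
    case 3
    have "collapse u w u = collapse u w w" by (simp add: collapse_apply)
    then have "u = w" by (rule inj_onD[OF gen.prems(2)]) (use uw 3 in auto)
    then show ?thesis using uw by simp
  qed
next
  case (mult s t)
  have "inj_on s (pverts H - {a})" using mult.prems(2) by (rule inj_on_imageI2)
  then obtain b \<pi> where \<pi>: "walk_perm (parcs H) a b \<pi>" "\<And>x. x \<in> pverts H - {a} \<Longrightarrow> s x = \<pi> x"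
    using mult.IH(1)[OF mult.prems(1)] by blast
  note E = pair_graph_facts(3)[OF assms(2)]
  have "b \<in> pverts H" using walk_perm_in[OF \<pi>(1) E mult.prems(1)] .
  have bij: "bij_betw \<pi> (pverts H - {a}) (pverts H - {b})"
    using walk_perm_bij_betw[OF \<pi>(1) E mult.prems(1)] .
  have "s ` (pverts H - {a}) = \<pi> ` (pverts H - {a})" using \<pi>(2) by (rule image_cong[OF refl])
  also have "\<dots> = pverts H - {b}" using bij by (simp add: bij_betw_def)
  finally have "inj_on t (pverts H - {b})" using mult.prems(2) by (metis inj_on_imageI)
  then obtain d \<rho> where \<rho>: "walk_perm (parcs H) b d \<rho>" "\<And>x. x \<in> pverts H - {b} \<Longrightarrow> t x = \<rho> x"
    using mult.IH(2)[OF \<open>b \<in> pverts H\<close>] by blast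
  have "\<forall>x\<in>pverts H - {a}. (t \<circ> s) x = (\<rho> \<circ> \<pi>) x"
    using \<pi>(2) \<rho>(2) bij_betwE[OF bij] by simp
  then show ?case using walk_perm_trans[OF \<rho>(1) \<pi>(1)] by blast
qed

text \<open>The hole moves along \<open>(b, c)\<close> when \<open>c\<close> is collapsed onto
  \<open>b\<close>. The map \<open>id\<close> stands in for the walk that stays.\<close>

lemma walk_perm_imp_flow_semigroup:
  assumes "walk_perm (parcs H) a b \<pi>" "sym (parcs H)"
  shows "\<exists>s. (s = id \<or> s \<in> flow_semigroup H) \<and> (\<forall>x. x \<noteq> a \<longrightarrow> s x = \<pi> x)"
  using assms(1)
proof (induction rule: walk_perm.induct)
  case stay
  then show ?case by blast
next
  case (step b \<pi> c)
  then obtain s where s: "s = id \<or> s \<in> flow_semigroup H" "\<And>x. x \<noteq> a \<Longrightarrow> s x = \<pi> x" by blast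
  have "collapse c b \<in> flow_semigroup H"
    using step.hyps(2) assms(2) by (blast intro: flow_semigroup.gen elim: symE)
  then have "collapse c b \<circ> s \<in> flow_semigroup H"
    using s(1) by (metis comp_id flow_semigroup.mult)
  moreover have "(collapse c b \<circ> s) x = (Transposition.transpose b c \<circ> \<pi>) x" if "x \<noteq> a" for x
  proof -
    \<comment> \<open>Only the token of the hole sits at \<open>b\<close>, and off \<open>b\<close>
      the collapsing agrees with the transposition.\<close>
    have "\<pi> x \<noteq> b"
      using walk_perm_start[OF step.hyps(1)] bij_is_inj[OF walk_perm_bij[OF step.hyps(1)]] that
      by (metis injD)
    then show ?thesis
      using s(2)[OF that] by (simp add: collapse_apply Transposition.transpose_def)
  qed
  ultimately show ?case by blast
qed

lemma restrict_Bij: "bij_betw \<pi> S S \<Longrightarrow> restrict \<pi> S \<in> Bij S"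
  by (simp add: Bij_def)

text \<open>Closed walks can be concatenated and reversed.\<close>

lemma subgroup_walk_perms:
  assumes "sym E" "E \<subseteq> V \<times> V" "c \<in> V"
  shows "subgroup {restrict \<pi> (V - {c}) | \<pi>. walk_perm E c c \<pi>} (BijGroup (V - {c}))"
    (is "subgroup ?K ?B")
proof -
  interpret B: group ?B by (rule group_BijGroup)
  have bij: "bij_betw \<pi> (V - {c}) (V - {c})" if "walk_perm E c c \<pi>" for \<pi>
    using walk_perm_bij_betw[OF that assms(2,3)] .
  have sub: "?K \<subseteq> carrier ?B" using bij by (auto simp: BijGroup_def intro!: restrict_Bij)
  have mult: "restrict \<rho> (V - {c}) \<otimes>\<^bsub>?B\<^esub> restrict \<pi> (V - {c}) = restrict (\<rho> \<circ> \<pi>) (V - {c})"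
    if "walk_perm E c c \<pi>" "walk_perm E c c \<rho>" for \<pi> \<rho>
    using bij[OF that(1)] bij[OF that(2)] restrict_Bij
    by (auto simp: BijGroup_def compose_def fun_eq_iff dest: bij_betwE)
  have one: "restrict id (V - {c}) = \<one>\<^bsub>?B\<^esub>" by (auto simp: BijGroup_def fun_eq_iff)
  show ?thesis
  proof (rule B.subgroupI[OF sub])
    show "?K \<noteq> {}" using walk_perm.stay[of E c] by blast
    show "x \<otimes>\<^bsub>?B\<^esub> y \<in> ?K" if xy: "x \<in> ?K" "y \<in> ?K" for x y
    proof -
      obtain \<rho> \<pi> where "x = restrict \<rho> (V - {c})" "walk_perm E c c \<rho>"
        "y = restrict \<pi> (V - {c})" "walk_perm E c c \<pi>" using xy by blast
      then have "x \<otimes>\<^bsub>?B\<^esub> y = restrict (\<rho> \<circ> \<pi>) (V - {c})" "walk_perm E c c (\<rho> \<circ> \<pi>)"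
        using mult walk_perm_trans by auto
      then show ?thesis by blast
    qed
    show "inv\<^bsub>?B\<^esub> x \<in> ?K" if x: "x \<in> ?K" for x
    proof -
      obtain \<pi> where \<pi>: "x = restrict \<pi> (V - {c})" "walk_perm E c c \<pi>" using x by blast
      let ?\<rho> = "inv_into UNIV \<pi>"
      have \<rho>: "walk_perm E c c ?\<rho>" using walk_perm_inv[OF \<pi>(2) assms(1)] .
      have "?\<rho> \<circ> \<pi> = id" using walk_perm_bij[OF \<pi>(2)] by (intro inv_o_cancel bij_is_inj)
      then have "restrict ?\<rho> (V - {c}) \<otimes>\<^bsub>?B\<^esub> x = \<one>\<^bsub>?B\<^esub>"
        using mult[OF \<pi>(2) \<rho>] \<pi>(1) one by simp
      moreover have "restrict ?\<rho> (V - {c}) \<in> ?K" using \<rho> by blast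
      ultimately have "inv\<^bsub>?B\<^esub> x = restrict ?\<rho> (V - {c})"
        using sub x by (intro B.inv_equality) auto
      then show ?thesis using \<rho> by blast
    qed
  qed
qed

text \<open>Every generator comes from a closed walk, and every closed walk gives a generator or the
  identity. As closed walks yield a subgroup, generation adds at most the identity.\<close>

lemma carrier_defect_group:
  assumes H: "pair_graph H" and c: "c \<in> pverts H"
  shows "carrier (defect_group H {c}) =
    {restrict \<pi> (pverts H - {c}) | \<pi>. walk_perm (parcs H) c c \<pi>}" (is "_ = ?K")
proof -
  let ?V = "pverts H" and ?B = "BijGroup (pverts H - {c})"
  let ?S = "{restrict s (?V - {c}) | s. s \<in> flow_semigroup H \<and> s ` (?V - {c}) = ?V - {c} \<and>
    s ` {c} \<subseteq> ?V - {c}}"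
  note H' = pair_graph_facts[OF H]
  interpret B: group ?B by (rule group_BijGroup)
  have K: "subgroup ?K ?B" by (rule subgroup_walk_perms[OF H'(1,3) c])
  have "?S \<subseteq> ?K"
  proof
    fix g assume "g \<in> ?S"
    then obtain s where s: "g = restrict s (?V - {c})" "s \<in> flow_semigroup H"
      "s ` (?V - {c}) = ?V - {c}" by blast
    have "inj_on s (?V - {c})" using s(3) H'(4) by (intro eq_card_imp_inj_on) auto
    then obtain b \<pi> where \<pi>: "walk_perm (parcs H) c b \<pi>" "\<And>x. x \<in> ?V - {c} \<Longrightarrow> s x = \<pi> x"
      using flow_semigroup_imp_walk_perm[OF s(2) H c] by blast
    have "?V - {c} = \<pi> ` (?V - {c})" using s(3) \<pi>(2) by (metis image_cong)
    also have "\<dots> = ?V - {b}"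
      using walk_perm_bij_betw[OF \<pi>(1) H'(3) c] by (simp add: bij_betw_def)
    finally have "b = c" using walk_perm_in[OF \<pi>(1) H'(3) c] by blast
    moreover have "g = restrict \<pi> (?V - {c})" unfolding s(1) using \<pi>(2) by (rule restrict_ext)
    ultimately show "g \<in> ?K" using \<pi>(1) by blast
  qed
  moreover have "?K \<subseteq> insert \<one>\<^bsub>?B\<^esub> ?S"
  proof
    fix g assume "g \<in> ?K"
    then obtain \<pi> where \<pi>: "g = restrict \<pi> (?V - {c})" "walk_perm (parcs H) c c \<pi>" by blast
    obtain s where s: "s = id \<or> s \<in> flow_semigroup H" "\<And>x. x \<noteq> c \<Longrightarrow> s x = \<pi> x"
      using walk_perm_imp_flow_semigroup[OF \<pi>(2) H'(1)] by blast
    have g: "g = restrict s (?V - {c})" unfolding \<pi>(1) using s(2) by (intro restrict_ext) auto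
    show "g \<in> insert \<one>\<^bsub>?B\<^esub> ?S"
    proof (cases "s = id")
      case True
      then show ?thesis using g by (auto simp: BijGroup_def fun_eq_iff)
    next
      case False
      then have flow: "s \<in> flow_semigroup H" using s(1) by blast
      have "s ` (?V - {c}) = \<pi> ` (?V - {c})" using s(2) by (intro image_cong) auto
      also have "\<dots> = ?V - {c}"
        using walk_perm_bij_betw[OF \<pi>(2) H'(3) c] by (simp add: bij_betw_def)
      finally have im: "s ` (?V - {c}) = ?V - {c}" .
      \<comment> \<open>If \<open>c\<close> were fixed, \<open>s\<close> would permute all of
        \<open>?V\<close>, but no element of the semigroup is injective there.\<close>
      have "s c \<noteq> c"
      proof
        assume "s c = c"
        then have "s ` insert c (?V - {c}) = insert c (?V - {c})" using im by (metis image_insert)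
        then have "s ` ?V = ?V" using c by (simp add: insert_absorb)
        then have "inj_on s ?V" using H'(4) by (intro eq_card_imp_inj_on) auto
        then show False using flow_semigroup_not_inj[OF flow H] by simp
      qed
      then have "s ` {c} \<subseteq> ?V - {c}" using flow_semigroup_image[OF flow H'(3)] c by auto
      then show ?thesis using g flow im by blast
    qed
  qed
  moreover have "?K \<subseteq> carrier ?B" using subgroup.subset[OF K] .
  ultimately have "generate ?B (carrier ?B \<inter> ?S) = ?K"
  proof (intro equalityI)
    assume S: "?S \<subseteq> ?K" "?K \<subseteq> insert \<one>\<^bsub>?B\<^esub> ?S" "?K \<subseteq> carrier ?B"
    show "generate ?B (carrier ?B \<inter> ?S) \<subseteq> ?K"
      by (rule B.generate_subgroup_incl[OF order_trans[OF inf_le2 S(1)] K])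
    show "?K \<subseteq> generate ?B (carrier ?B \<inter> ?S)"
    proof
      fix g assume g: "g \<in> ?K"
      show "g \<in> generate ?B (carrier ?B \<inter> ?S)"
        using subsetD[OF S(2) g]
      proof (rule insertE)
        show "g \<in> generate ?B (carrier ?B \<inter> ?S)" if "g = \<one>\<^bsub>?B\<^esub>"
          unfolding that by (rule generate.one)
        show "g \<in> generate ?B (carrier ?B \<inter> ?S)" if "g \<in> ?S"
          by (rule generate.incl[OF IntI[OF subsetD[OF S(3) g] that]])
      qed
    qed
  qed
  then show ?thesis by (simp add: defect_group_def carrier_subgroup_generated)
qed

lemma defect_group_subset_Bij:
  assumes "pair_graph H" "c \<in> pverts H"
  shows "carrier (defect_group H {c}) \<subseteq> Bij (pverts H - {c})"
  using walk_perm_bij_betw[OF _ pair_graph_facts(3)[OF assms(1)] assms(2)]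
  unfolding carrier_defect_group[OF assms] by (blast intro: restrict_Bij)

lemma mult_defect_group:
  assumes "pair_graph H" "c \<in> pverts H"
    and "f \<in> carrier (defect_group H {c})" "g \<in> carrier (defect_group H {c})"
  shows "f \<otimes>\<^bsub>defect_group H {c}\<^esub> g = compose (pverts H - {c}) f g"
proof -
  have "f \<in> Bij (pverts H - {c})" "g \<in> Bij (pverts H - {c})"
    using defect_group_subset_Bij[OF assms(1,2)] assms(3,4) by auto
  then show ?thesis by (simp add: defect_group_def BijGroup_def)
qed

section \<open>Blocks as vertex sets\<close>

lemma rtrancl_on_cong:
  assumes "Restr E S \<subseteq> F"
  shows "rtrancl_on S E \<subseteq> rtrancl_on S F"
proof (clarify)
  fix x y assume "(x, y) \<in> rtrancl_on S E"
  then show "(x, y) \<in> rtrancl_on S F"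
  proof (induction rule: rtrancl_on_induct)
    case (step y z)
    then have "(y, z) \<in> F" using assms by auto
    then show ?case using step by (meson rtrancl_on_into_rtrancl_on)
  qed auto
qed

lemma conn_mono: "conn E S \<Longrightarrow> Restr E S \<subseteq> F \<Longrightarrow> conn F S"
  unfolding conn_def using rtrancl_on_cong by blast

lemma two_conn_mono:
  assumes "two_conn E S" "Restr E S \<subseteq> F"
  shows "two_conn F S"
  using assms conn_mono[of E _ F] unfolding two_conn_def by blast

text \<open>Library connectedness is strong connectedness of the symmetric closure, which adds
  nothing to a symmetric relation.\<close>

lemma connected_iff_conn:
  assumes "arcs_ends G = E" "sym E"
  shows "Digraph_Component.connected G \<longleftrightarrow> conn E (verts G)"
proof -
  have "parcs (mk_symmetric G) = E"
    using assms by (fastforce simp: parcs_mk_symmetric arcs_ends_conv elim: symE)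
  then show ?thesis
    by (simp add: Digraph_Component.connected_def strongly_connected_def conn_def reachable_def)
qed

lemma two_vertex_connected_iff:
  assumes "pair_graph H"
  shows "two_vertex_connected H \<longleftrightarrow> two_conn (parcs H) (pverts H)"
proof -
  note H = pair_graph_facts[OF assms]
  have "Digraph_Component.connected (with_proj H) \<longleftrightarrow> conn (parcs H) (pverts H)"
    using connected_iff_conn[of "with_proj H"] H(1) by simp
  moreover have "Digraph_Component.connected (pre_digraph.del_vert (with_proj H) z) \<longleftrightarrow>
      conn (parcs H) (pverts H - {z})" for z
  proof -
    \<comment> \<open>Deletion of \<open>z\<close> also removes its arcs, but connectivity on a set
      without \<open>z\<close> does not see them.\<close>
    let ?E = "Restr (parcs H) (- {z})"
    have "arcs_ends (pre_digraph.del_vert (with_proj H) z) = ?E"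
      by (force simp: arcs_ends_conv pre_digraph.del_vert_def)
    moreover have "sym ?E" using H(1) by (auto simp: sym_def)
    ultimately have "Digraph_Component.connected (pre_digraph.del_vert (with_proj H) z) \<longleftrightarrow>
        conn ?E (pverts H - {z})"
      using connected_iff_conn[of "pre_digraph.del_vert (with_proj H) z" ?E]
      by (simp add: pre_digraph.del_vert_def)
    then show ?thesis
      using conn_mono[of ?E "pverts H - {z}" "parcs H"] conn_mono[of "parcs H" "pverts H - {z}" ?E] by blast
  qed
  ultimately show ?thesis by (simp add: two_vertex_connected_def two_conn_def)
qed

lemma subgraph_with_proj_iff:
  assumes "pair_graph H" "pair_graph K"
  shows "subgraph (with_proj H) (with_proj K) \<longleftrightarrow> pverts H \<subseteq> pverts K \<and> parcs H \<subseteq> parcs K"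
proof -
  have "wf_digraph (with_proj H)" "wf_digraph (with_proj K)"
    using assms by (auto simp: wf_digraph_wp_iff pair_graph_def pair_digraph_def pair_fin_digraph_def)
  then show ?thesis by (auto simp: subgraph_def compatible_def)
qed

definition induced :: "'a rel \<Rightarrow> 'a set \<Rightarrow> 'a pair_pre_digraph"
  where "induced E S = \<lparr>pverts = S, parcs = Restr E S\<rparr>"

lemma induced_simps [simp]: "pverts (induced E S) = S" "parcs (induced E S) = Restr E S"
  by (simp_all add: induced_def)

lemma pair_graph_induced:
  assumes "pair_graph G" "S \<subseteq> pverts G"
  shows "pair_graph (induced (parcs G) S)"
proof -
  note G = pair_graph_facts[OF assms(1)]
  have "finite S" using assms(2) G(4) by (rule finite_subset)
  moreover have "sym (Restr (parcs G) S)" using G(1) by (auto simp: sym_def)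
  ultimately show ?thesis
    using G(2) by unfold_locales (auto simp: symmetric_def)
qed

text \<open>Adding all arcs between its vertices keeps a subgraph 2-connected. Hence maximal ones
  are induced, and maximality can be tested on vertex sets.\<close>

lemma blocks_iff:
  assumes G: "pair_graph G" and R: "rooted_graph (parcs G) (pverts G) v"
  shows "H \<in> blocks G \<longleftrightarrow>
    rooted_graph.block (parcs G) (pverts G) (pverts H) \<and> H = induced (parcs G) (pverts H)"
proof -
  interpret rooted_graph "parcs G" "pverts G" v by (rule R)
  let ?P = "\<lambda>K. pair_graph K \<and> subgraph (with_proj K) (with_proj G) \<and> two_vertex_connected K"
  have P_induced: "?P (induced (parcs G) T)" if "T \<subseteq> pverts G" "two_conn (parcs G) T" for T
  proof -
    have "pair_graph (induced (parcs G) T)" by (rule pair_graph_induced[OF G that(1)])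
    moreover have "two_conn (Restr (parcs G) T) T" using that(2) by (rule two_conn_mono) auto
    ultimately show ?thesis
      using that G by (simp add: subgraph_with_proj_iff two_vertex_connected_iff)
  qed
  have PD: "pverts K \<subseteq> pverts G" "parcs K \<subseteq> Restr (parcs G) (pverts K)" "two_conn (parcs G) (pverts K)"
    "pair_graph K" if "?P K" for K
  proof -
    have K: "pair_graph K" "pverts K \<subseteq> pverts G" "parcs K \<subseteq> parcs G" "two_conn (parcs K) (pverts K)"
      using that G by (auto simp: subgraph_with_proj_iff two_vertex_connected_iff)
    then show "pverts K \<subseteq> pverts G" "parcs K \<subseteq> Restr (parcs G) (pverts K)"
      "two_conn (parcs G) (pverts K)" "pair_graph K"
      using pair_graph_facts(3)[OF K(1)] by (auto intro: two_conn_mono)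
  qed
  have blocks: "H \<in> blocks G \<longleftrightarrow> ?P H \<and> (\<forall>K. ?P K \<and> subgraph (with_proj H) (with_proj K) \<longrightarrow> K = H)"
    unfolding blocks_def by blast
  show ?thesis
  proof
    assume H: "H \<in> blocks G"
    then have PH: "?P H" and max: "\<And>K. ?P K \<Longrightarrow> subgraph (with_proj H) (with_proj K) \<Longrightarrow> K = H"
      using blocks by blast+
    note H' = PD[OF PH]
    have max': "induced (parcs G) T = H" if "pverts H \<subseteq> T" "T \<subseteq> pverts G" "two_conn (parcs G) T" for T
    proof (rule max[OF P_induced[OF that(2,3)]])
      show "subgraph (with_proj H) (with_proj (induced (parcs G) T))"
        using H' that pair_graph_induced[OF G that(2)] by (auto simp: subgraph_with_proj_iff)
    qed
    have "T = pverts H" if "pverts H \<subseteq> T" "T \<subseteq> pverts G" "two_conn (parcs G) T" for T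
      using max'[OF that] by (metis induced_simps(1))
    then have "block (pverts H)" using H' by (auto simp: block_def)
    moreover have "H = induced (parcs G) (pverts H)" using max'[OF order_refl] H' by simp
    ultimately show "block (pverts H) \<and> H = induced (parcs G) (pverts H)" by blast
  next
    assume H: "block (pverts H) \<and> H = induced (parcs G) (pverts H)"
    have PH: "?P H" using P_induced[of "pverts H"] H blockD(1,2)[of "pverts H"] by simp
    have "K = H" if K: "?P K" and HK: "subgraph (with_proj H) (with_proj K)" for K
    proof -
      have sub: "pverts H \<subseteq> pverts K" "parcs H \<subseteq> parcs K"
        using HK PD(4)[OF K] PD(4)[OF PH] by (auto simp: subgraph_with_proj_iff)
      have eq: "pverts K = pverts H"
        using H PD[OF K] sub by (intro blockD(3)) auto
      have "parcs H = Restr (parcs G) (pverts H)" using H by (metis induced_simps(2))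
      then have "parcs K = parcs H" using sub PD(2)[OF K] eq by auto
      then show ?thesis using eq by (intro pair_pre_digraph.equality) auto
    qed
    then show "H \<in> blocks G" using PH blocks by blast
  qed
qed

section \<open>Assembling the isomorphism of permutation groups\<close>

theorem theorem1p1:
  fixes G :: "'a pair_pre_digraph"
    and v :: 'a
    and c :: "'a pair_pre_digraph \<Rightarrow> 'a"
  assumes "pair_graph G"
    and "Digraph_Component.connected (with_proj G)"
    and "v \<in> pverts G"
    and "\<And>B. B \<in> blocks G \<Longrightarrow> c B \<in> pverts B"
  shows "\<exists>h \<phi>.
      h \<in> iso (defect_group G {v}) (product_group (blocks G) (\<lambda>B. defect_group B {c B})) \<and>
      bij_betw \<phi> (pverts G - {v}) (SIGMA B:blocks G. pverts B - {c B}) \<and>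
      (\<forall>g\<in>carrier (defect_group G {v}). \<forall>x\<in>pverts G - {v}.
         \<phi> (g x) = (case \<phi> x of (B, y) \<Rightarrow> (B, h g B y)))"
proof -
  let ?E = "parcs G" and ?V = "pverts G" and ?D = "defect_group G {v}"
  note G = pair_graph_facts[OF assms(1)]
  have R: "rooted_graph ?E ?V v"
    using G assms(2,3) connected_iff_conn[of "with_proj G"] by unfold_locales auto
  interpret rooted_graph ?E ?V v by (rule R)
  have block: "block (pverts B)" "parcs B = Restr ?E (pverts B)" "pair_graph B" "c B \<in> pverts B"
    if "B \<in> blocks G" for B
  proof -
    have *: "block (pverts B)" "B = induced ?E (pverts B)"
      using that blocks_iff[OF assms(1) R] by blast+
    show "block (pverts B)" by (fact *(1))
    show "parcs B = Restr ?E (pverts B)" using *(2) by (metis induced_simps(2))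
    show "pair_graph B" using *(2) pair_graph_induced[OF assms(1) blockD(1)[OF *(1)]] by simp
    show "c B \<in> pverts B" using assms(4)[OF that] .
  qed
  \<comment> \<open>\<open>P B\<close> holds the tokens of \<open>B\<close> while the hole is at the
    root, \<open>Q B\<close> those while it is at the prescribed vertex \<open>c B\<close>.\<close>
  define P where "P B = pverts B - {root (pverts B)}" for B :: "'a pair_pre_digraph"
  define Q where "Q B = pverts B - {c B}" for B
  \<comment> \<open>A walk inside \<open>B\<close> from its root to \<open>c B\<close>; conjugation
    with it changes the base point.\<close>
  have "\<exists>\<kappa>. walk_perm (parcs B) (root (pverts B)) (c B) \<kappa>" if "B \<in> blocks G" for B
    using walk_perm_exists[OF conn_rtrancl_on[OF blockD(5) root_props(1)]] block[OF that] by metis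
  then obtain \<kappa> where \<kappa>: "\<And>B. B \<in> blocks G \<Longrightarrow> walk_perm (parcs B) (root (pverts B)) (c B) (\<kappa> B)"
    by metis
  define \<kappa>' where "\<kappa>' B = inv_into UNIV (\<kappa> B)" for B
  have \<kappa>': "walk_perm (parcs B) (c B) (root (pverts B)) (\<kappa>' B)" if "B \<in> blocks G" for B
    unfolding \<kappa>'_def using walk_perm_inv[OF \<kappa>[OF that]] pair_graph_facts(1)[OF block(3)[OF that]] by simp
  have inv1: "\<kappa>' B (\<kappa> B x) = x" if "B \<in> blocks G" for B x
    unfolding \<kappa>'_def using walk_perm_bij[OF \<kappa>[OF that]] by (simp add: bij_is_inj)
  have inv2: "\<kappa> B (\<kappa>' B x) = x" if "B \<in> blocks G" for B x
    unfolding \<kappa>'_def using walk_perm_bij[OF \<kappa>[OF that]] by (simp add: bij_is_surj surj_f_inv_f)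
  have \<kappa>_in: "\<kappa> B x \<in> Q B" if "B \<in> blocks G" "x \<in> P B" for B x
    using bij_betwE[OF walk_perm_bij_betw[OF \<kappa>[OF that(1)] pair_graph_facts(3)[OF block(3)[OF that(1)]]]]
      root_props(1)[OF block(1)[OF that(1)]] that(2)
    by (simp add: P_def Q_def)
  have \<kappa>'_in: "\<kappa>' B x \<in> P B" if "B \<in> blocks G" "x \<in> Q B" for B x
    using bij_betwE[OF walk_perm_bij_betw[OF \<kappa>'[OF that(1)] pair_graph_facts(3)[OF block(3)[OF that(1)]]]]
      block(4)[OF that(1)] that(2)
    by (simp add: P_def Q_def)
  have P_unique: "B = B'" if "B \<in> blocks G" "B' \<in> blocks G" "x \<in> P B" "x \<in> P B'" for B B' x
  proof -
    have "pverts B = pverts B'"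
      using block_root_unique[OF block(1) block(1)] that unfolding P_def by blast
    then show ?thesis using that blocks_iff[OF assms(1) R] by metis
  qed
  have P_sub: "P B \<subseteq> ?V - {v}" if "B \<in> blocks G" for B
    using blockD(1)[OF block(1)[OF that]] root_eq_base[OF block(1)[OF that]] by (auto simp: P_def)
  have P_cover: "\<exists>B\<in>blocks G. x \<in> P B" if x: "x \<in> ?V - {v}" for x
  proof -
    obtain S where S: "block S" "x \<in> S - {root S}" using parent_block_exists x by blast
    then have "induced ?E S \<in> blocks G" by (simp add: blocks_iff[OF assms(1) R])
    then show ?thesis using S(2) by (intro bexI[of _ "induced ?E S"]) (auto simp: P_def)
  qed
  define par where "par x = (THE B. B \<in> blocks G \<and> x \<in> P B)" for x
  have par: "par x = B" if "B \<in> blocks G" "x \<in> P B" for B x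
    unfolding par_def using that P_unique by blast
  define \<phi> where "\<phi> x = (par x, \<kappa> (par x) x)" for x
  have \<phi>: "\<phi> x = (B, \<kappa> B x)" if "B \<in> blocks G" "x \<in> P B" for B x
    using par[OF that] by (simp add: \<phi>_def)
  \<comment> \<open>The action of \<open>g\<close> on \<open>P B\<close> is transported to
    \<open>Q B\<close>. The restricted abstractions give \<open>undefined\<close> elsewhere, since
    elements of the product and of \<open>BijGroup\<close> are extensional.\<close>
  define h where "h g = (\<lambda>B\<in>blocks G. \<lambda>y\<in>Q B. \<kappa> B (g (\<kappa>' B y)))" for g
  have h: "h g B y = \<kappa> B (g (\<kappa>' B y))" if "B \<in> blocks G" "y \<in> Q B" for g B y
    using that by (simp add: h_def)
  have carrier_D: "carrier ?D = {restrict \<pi> (?V - {v}) | \<pi>. walk_perm ?E v v \<pi>}"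
    by (rule carrier_defect_group[OF assms(1,3)])
  have carrier_B: "carrier (defect_group B {c B}) = {restrict \<rho> (Q B) | \<rho>. walk_perm (parcs B) (c B) (c B) \<rho>}"
    if "B \<in> blocks G" for B
    unfolding Q_def by (rule carrier_defect_group[OF block(3,4)[OF that]])
  have local: "\<exists>\<beta>. walk_perm (parcs B) (root (pverts B)) (root (pverts B)) \<beta> \<and> (\<forall>x\<in>P B. g x = \<beta> x)"
    if g: "g \<in> carrier ?D" and B: "B \<in> blocks G" for g B
  proof -
    obtain \<pi> where \<pi>: "g = restrict \<pi> (?V - {v})" "walk_perm ?E v v \<pi>" using g carrier_D by blast
    obtain \<beta> where "walk_perm (parcs B) (root (pverts B)) (root (pverts B)) \<beta>" "\<forall>x\<in>P B. \<pi> x = \<beta> x"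
      using walk_perm_closed_block_perms[OF \<pi>(2)] block(1,2)[OF B] unfolding block_perms_def P_def
      by auto
    then show ?thesis using P_sub[OF B] \<pi>(1) by (intro exI[of _ \<beta>]) (simp add: subset_iff)
  qed
  have g_in: "g x \<in> P B" if g: "g \<in> carrier ?D" and B: "B \<in> blocks G" and x: "x \<in> P B" for g B x
  proof -
    obtain \<beta> where \<beta>: "walk_perm (Restr ?E (pverts B)) (root (pverts B)) (root (pverts B)) \<beta>" "g x = \<beta> x"
      using local[OF g B] x block(2)[OF B] by auto
    show ?thesis
      using bij_betwE[OF block_perm_bij[OF block(1)[OF B] \<beta>(1)]] x \<beta>(2) by (simp add: P_def)
  qed
  have h_in: "h g B \<in> carrier (defect_group B {c B})" if g: "g \<in> carrier ?D" and B: "B \<in> blocks G" for g B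
  proof -
    obtain \<beta> where \<beta>: "walk_perm (parcs B) (root (pverts B)) (root (pverts B)) \<beta>" "\<forall>x\<in>P B. g x = \<beta> x"
      using local[OF g B] by blast
    have "h g B = restrict (\<kappa> B \<circ> (\<beta> \<circ> \<kappa>' B)) (Q B)"
      using B \<beta>(2) \<kappa>'_in[OF B] by (simp add: h_def fun_eq_iff)
    moreover have "walk_perm (parcs B) (c B) (c B) (\<kappa> B \<circ> (\<beta> \<circ> \<kappa>' B))"
      using \<kappa>[OF B] \<beta>(1) \<kappa>'[OF B] by (blast intro: walk_perm_trans)
    ultimately show ?thesis using carrier_B[OF B] by blast
  qed
  have hom: "h \<in> hom ?D (product_group (blocks G) (\<lambda>B. defect_group B {c B}))"
  proof (rule homI)
    show "h g \<in> carrier (product_group (blocks G) (\<lambda>B. defect_group B {c B}))"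
      if "g \<in> carrier ?D" for g
      using h_in[OF that] by (auto simp: h_def)
    show "h (f \<otimes>\<^bsub>?D\<^esub> g) = h f \<otimes>\<^bsub>product_group (blocks G) (\<lambda>B. defect_group B {c B})\<^esub> h g"
      if f: "f \<in> carrier ?D" and g: "g \<in> carrier ?D" for f g
    proof -
      have "h (f \<otimes>\<^bsub>?D\<^esub> g) B = h f B \<otimes>\<^bsub>defect_group B {c B}\<^esub> h g B" if B: "B \<in> blocks G" for B
      proof
        fix y
        have eq: "h f B \<otimes>\<^bsub>defect_group B {c B}\<^esub> h g B = compose (Q B) (h f B) (h g B)"
          unfolding Q_def using mult_defect_group[OF block(3,4)[OF B] h_in[OF f B] h_in[OF g B]] .
        have fg: "f \<otimes>\<^bsub>?D\<^esub> g = compose (?V - {v}) f g" by (rule mult_defect_group[OF assms(1,3) f g])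
        show "h (f \<otimes>\<^bsub>?D\<^esub> g) B y = (h f B \<otimes>\<^bsub>defect_group B {c B}\<^esub> h g B) y"
        proof (cases "y \<in> Q B")
          case True
          have "\<kappa>' B y \<in> ?V - {v}" "g (\<kappa>' B y) \<in> P B"
            using \<kappa>'_in[OF B True] P_sub[OF B] g_in[OF g B] by auto
          then show ?thesis
            unfolding eq fg using True B \<kappa>_in[OF B]
            by (simp add: h compose_eq inv1)
        next
          case False
          then show ?thesis unfolding eq using B by (simp add: h_def compose_def)
        qed
      qed
      then show ?thesis by (auto simp: h_def fun_eq_iff)
    qed
  qed
  have inj: "inj_on h (carrier ?D)"
  proof (rule inj_onI)
    fix f g assume f: "f \<in> carrier ?D" and g: "g \<in> carrier ?D" and eq: "h f = h g"
    have ext: "f \<in> extensional (?V - {v})" "g \<in> extensional (?V - {v})"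
      using f g defect_group_subset_Bij[OF assms(1,3)] Bij_imp_extensional by blast+
    \<comment> \<open>The values on the sets \<open>P B\<close>, which cover
      \<open>?V - {v}\<close>, determine an extensional map.\<close>
    show "f = g"
    proof (rule extensionalityI[OF ext])
      fix x assume "x \<in> ?V - {v}"
      then obtain B where B: "B \<in> blocks G" "x \<in> P B" using P_cover by blast
      have "\<kappa> B (f x) = \<kappa> B (g x)"
        using h[OF B(1) \<kappa>_in[OF B], of f] h[OF B(1) \<kappa>_in[OF B], of g] eq inv1[OF B(1)] by simp
      then show "f x = g x" using inv1[OF B(1)] by metis
    qed
  qed
  have surj: "\<exists>g\<in>carrier ?D. h g = f" if f: "f \<in> (\<Pi>\<^sub>E B\<in>blocks G. carrier (defect_group B {c B}))" for f
  proof -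
    have "\<exists>\<rho>. f B = restrict \<rho> (Q B) \<and> walk_perm (parcs B) (c B) (c B) \<rho>" if "B \<in> blocks G" for B
      using PiE_mem[OF f that] carrier_B[OF that] by blast
    then obtain \<rho> where \<rho>: "\<And>B. B \<in> blocks G \<Longrightarrow> f B = restrict (\<rho> B) (Q B)"
      "\<And>B. B \<in> blocks G \<Longrightarrow> walk_perm (parcs B) (c B) (c B) (\<rho> B)" by metis
    \<comment> \<open>The prescribed tours based at \<open>c B\<close> are carried back to the
      roots, where one closed walk from \<open>v\<close> realises them all.\<close>
    define \<beta> where "\<beta> B = \<kappa>' B \<circ> (\<rho> B \<circ> \<kappa> B)" for B
    have \<beta>: "walk_perm (parcs B) (root (pverts B)) (root (pverts B)) (\<beta> B)" if "B \<in> blocks G" for B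
      unfolding \<beta>_def using \<kappa>[OF that] \<rho>(2)[OF that] \<kappa>'[OF that] by (blast intro: walk_perm_trans)
    \<comment> \<open>In the locale blocks are vertex sets; \<open>induced ?E S\<close> is the block
      graph on \<open>S\<close>.\<close>
    have "walk_perm (Restr ?E S) (root S) (root S) (\<beta> (induced ?E S))" if "block S" for S
      using \<beta>[of "induced ?E S"] that by (simp add: blocks_iff[OF assms(1) R])
    then obtain \<pi> where \<pi>: "walk_perm ?E v v \<pi>"
      "\<And>S x. block S \<Longrightarrow> x \<in> S - {root S} \<Longrightarrow> \<pi> x = \<beta> (induced ?E S) x"
      using block_family_closed_walk[of "\<lambda>S. \<beta> (induced ?E S)"] by blast
    have \<pi>_P: "\<pi> x = \<beta> B x" if "B \<in> blocks G" "x \<in> P B" for B x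
      using \<pi>(2)[OF block(1)[OF that(1)]] that blocks_iff[OF assms(1) R, of B] by (simp add: P_def)
    let ?g = "restrict \<pi> (?V - {v})"
    have "h ?g B y = f B y" if B: "B \<in> blocks G" for B y
    proof (cases "y \<in> Q B")
      case True
      have "\<kappa>' B y \<in> P B" "\<kappa>' B y \<in> ?V - {v}" using \<kappa>'_in[OF B True] P_sub[OF B] by auto
      then have "h ?g B y = \<kappa> B (\<beta> B (\<kappa>' B y))" using h[OF B True] \<pi>_P[OF B] by simp
      also have "\<dots> = \<rho> B y" by (simp add: \<beta>_def inv2[OF B])
      finally show ?thesis using \<rho>(1)[OF B] True by simp
    next
      case False
      then show ?thesis using \<rho>(1)[OF B] B by (simp add: h_def)
    qed
    then have "h ?g = f"
      using f by (intro extensionalityI[of _ "blocks G"]) (auto simp: h_def PiE_def)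
    moreover have "?g \<in> carrier ?D" using \<pi>(1) carrier_D by blast
    ultimately show ?thesis by blast
  qed
  have "h \<in> iso ?D (product_group (blocks G) (\<lambda>B. defect_group B {c B}))"
    using hom inj surj hom_carrier[OF hom] by (fastforce simp: iso_def bij_betw_def)
  moreover have "bij_betw \<phi> (?V - {v}) (SIGMA B:blocks G. Q B)"
  proof (rule bij_betwI')
    fix x y assume xy: "x \<in> ?V - {v}" "y \<in> ?V - {v}"
    obtain A B where "A \<in> blocks G" "x \<in> P A" "B \<in> blocks G" "y \<in> P B" using P_cover xy by meson
    then show "(\<phi> x = \<phi> y) = (x = y)" using \<phi> inv1 by (metis Pair_inject)
  next
    fix x assume "x \<in> ?V - {v}"
    then show "\<phi> x \<in> (SIGMA B:blocks G. Q B)" using P_cover \<phi> \<kappa>_in by fastforce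
  next
    fix p assume "p \<in> (SIGMA B:blocks G. Q B)"
    then obtain B y where p: "p = (B, y)" "B \<in> blocks G" "y \<in> Q B" by blast
    then have "p = \<phi> (\<kappa>' B y)" using \<phi>[OF p(2) \<kappa>'_in] inv2 by simp
    then show "\<exists>x\<in>?V - {v}. p = \<phi> x" using \<kappa>'_in[OF p(2,3)] P_sub[OF p(2)] by blast
  qed
  \<comment> \<open>Equivariance makes \<open>h\<close> an isomorphism of permutation groups: the
    product acts coordinatewise on the disjoint union of the token sets \<open>Q B\<close>.\<close>
  moreover have "\<phi> (g x) = (case \<phi> x of (B, y) \<Rightarrow> (B, h g B y))"
    if g: "g \<in> carrier ?D" and x: "x \<in> ?V - {v}" for g x
  proof -
    obtain B where B: "B \<in> blocks G" "x \<in> P B" using P_cover x by blast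
    show ?thesis
      using \<phi>[OF B] \<phi>[OF B(1) g_in[OF g B]] h[OF B(1) \<kappa>_in[OF B], of g] inv1[OF B(1)] by simp
  qed
  ultimately show ?thesis unfolding Q_def by blast
qed

end
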